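(* Consider an $n$-end-node star network with bit-flip channels with parameter vector $\theta=(\theta_0,\dots,\theta_{n-1})$, and the $(n-1)$-qubit state $\rho(\theta)$ received by end-nodes $1,\dots,n-1$ in the $Z$-basis distribution process. (i) The state is $$\rho(\theta)=\sum_{s\in\{0,1\}^{n-1}}\alpha(s)\,|s\rangle\langle s|,$$ $$\alpha(s)=\theta_0\prod_{j:\,s_j=0}\theta_j\prod_{j:\,s_j=1}(1-\theta_j)+(1-\theta_0)\prod_{j:\,s_j=1}\theta_j\prod_{j:\,s_j=0}(1-\theta_j),$$ with all products over $j\in\{1,\dots,n-1\}$. (ii) Let $S_j\in\{0,1\}$ be the outcome of measuring the qubit of node $j$ in the $Z$ basis, and put $p_j=\Pr[S_j=1]$, $p_{jk}=\Pr[S_j=1,S_k=1]$. Then, for distinct $j,k\in\{1,\dots,n-1\}$, $$p_j=\theta_0(1-\theta_j)+(1-\theta_0)\theta_j,\qquad p_{jk}=\theta_0(1-\theta_j)(1-\theta_k)+(1-\theta_0)\theta_j\theta_k .$$ For $\theta_0\neq\frac12$ this gives $$\theta_j=\frac{p_j-\theta_0}{1-2\theta_0}\quad\text{for all } j\in\{1,\dots,n-1\},$$ and $\theta_0$ satisfies the quadratic equation $$a_{jk}(1-\theta_0)\theta_0+c_{jk}=0,\qquad a_{jk}=1+4p_{jk}-2(p_j+p_k),\quad c_{jk}=p_jp_k-p_{jk}.$$ (iii) If $\theta^*$ solves this quadratic equation, so does $1-\theta^*$. Hence solving it for a pair $(j,k)$ determines two possible values of $\theta_0$ that are valid for the measurement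 results, and this symmetry cannot be broken even by considering the equation for all pairs of end-nodes. Combining the equations for $p_1,\dots,p_{n-1}$ with the quadratic equation gives two vectors $\hat\theta$ of channel parameters that are compatible with the observations, so the estimators obtained in this way do not completely identify the parameters. Identifiability can be obtained by assuming either a low-noise or a high-noise regime for $\theta_0$: one selects the solution of the quadratic equation that is greater than $\frac12$ in the low-noise regime, and the one that is smaller than $\frac12$ in the high-noise regime.
   Context: A star quantum network has $n$ end-nodes $0,\dots,n-1$ and one intermediate node. End-node $j$ is joined to the intermediate node by the single-qubit bit-flip channel $\mathcal{E}_j(\rho)=\theta_j\rho+(1-\theta_j)X\rho X$, where $X$ is the Pauli $X$ operator and the probability $\theta_j$ is unknown. Operations and measurements at nodes are noiseless. The $Z$-basis distribution process is as follows. Node $0$ (the root) sends a qubit in state $|0\rangle$ to the intermediate node through $\mathcal{E}_0$. The intermediate node applies the gate $|0\rangle\langle0|\otimes I^{\otimes(n-2)}+|1\rangle\langle1|\otimes X^{\otimes(n-2)}$ to the received qubit (the control) and $n-2$ qubits of its register initialized in $|0\rangle$. This produces the state $\theta_0(|0\rangle\langle0|)^{\otimes(n-1)}+(1-\theta_0)(|1\rangle\langle1|)^{\otimes(n-1)}$. It then sends one of these $n-1$ qubits to each end-node $j=1,\dots,n-1$ through $\mathcal{E}_j$. The resulting state is $\rho(\theta)$. The string $s=(s_1,\dots,s_{n-1})$ labels the computational ($Z$) basis, with $s_j$ belonging to node $j$. The estimators are obtained by replacing $p_j$ and $p_{jk}$ with their estimates from measurement outcomes and solving the resulting equations. Parameters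 are said to be identified if the solution is unique.
   Formalization: In (iii), the claims of exactly two values, exactly two vectors and identifiability by noise regime assume a_jk ≠ 0 for a pair used (exactly: θ_j, θ_k ≠ 1/2) and a root θ_0 ≠ 1/2; if a_jk = 0 the exact equation is 0 = 0 and they fail. *)

theory Defs
  imports
    "Jordan_Normal_Form.Matrix"
    "Jordan_Normal_Form.Schur_Decomposition"
    "HOL-Library.FuncSet"
begin

section \<open>Qubit operators\<close>

definition ketbra :: "nat \<Rightarrow> nat \<Rightarrow> complex mat" where
  "ketbra a b = mat 2 2 (\<lambda>(i, j). if i = a \<and> j = b then 1 else 0)"

definition Pauli_X :: "complex mat" where
  "Pauli_X = mat_of_rows_list 2 [[0, 1], [1, 0]]"

text \<open>The Kronecker product; the left factor is the most significant one.\<close>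

definition tensor :: "complex mat \<Rightarrow> complex mat \<Rightarrow> complex mat" (infixr "\<otimes>\<^sub>m" 72) where
  "A \<otimes>\<^sub>m B = mat (dim_row A * dim_row B) (dim_col A * dim_col B)
     (\<lambda>(i, j). A $$ (i div dim_row B, j div dim_col B) * B $$ (i mod dim_row B, j mod dim_col B))"

definition tensors :: "complex mat list \<Rightarrow> complex mat" where
  "tensors As = foldr (\<otimes>\<^sub>m) As (1\<^sub>m 1)"

definition trace :: "complex mat \<Rightarrow> complex" where
  "trace A = (\<Sum>i<dim_row A. A $$ (i, i))"

text \<open>The product operator whose factor on the qubit of end-node \<open>j\<close> is \<open>A j\<close>, for
  \<open>j = 1, \<dots>, n - 1\<close> in this order.\<close>

definition node_op :: "nat \<Rightarrow> (nat \<Rightarrow> complex mat) \<Rightarrow> complex mat" where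
  "node_op n A = tensors (map A [1..<n])"


section \<open>The distribution process\<close>

text \<open>For a single qubit, \<open>V\<close> is \<open>Pauli_X\<close>. The channel on one qubit of a register, tensored with
  the identity channel on all others, is obtained with \<open>V\<close> the operator that applies \<open>Pauli_X\<close>
  to that qubit only.\<close>

definition bit_flip :: "complex mat \<Rightarrow> real \<Rightarrow> complex mat \<Rightarrow> complex mat" where
  "bit_flip V t \<rho> = complex_of_real t \<cdot>\<^sub>m \<rho> + complex_of_real (1 - t) \<cdot>\<^sub>m (V * \<rho> * V)"

definition X_at :: "nat \<Rightarrow> nat \<Rightarrow> complex mat" where
  "X_at n j = node_op n (\<lambda>i. if i = j then Pauli_X else 1\<^sub>m 2)"

definition fanout :: "nat \<Rightarrow> complex mat" where
  "fanout n = ketbra 0 0 \<otimes>\<^sub>m tensors (replicate (n - 2) (1\<^sub>m 2))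
            + ketbra 1 1 \<otimes>\<^sub>m tensors (replicate (n - 2) Pauli_X)"

text \<open>A parameter vector of an \<open>n\<close>-end-node star has the components \<open>\<theta> $ 0, \<dots>, \<theta> $ (n - 1)\<close>.\<close>

definition parameters :: "nat \<Rightarrow> real vec set" where
  "parameters n = {\<theta> \<in> carrier_vec n. \<forall>j<n. 0 \<le> \<theta> $ j \<and> \<theta> $ j \<le> 1}"

definition intermediate_state :: "nat \<Rightarrow> real vec \<Rightarrow> complex mat" where
  "intermediate_state n \<theta> =
     fanout n
     * (bit_flip Pauli_X (\<theta> $ 0) (ketbra 0 0) \<otimes>\<^sub>m tensors (replicate (n - 2) (ketbra 0 0)))
     * mat_adjoint (fanout n)"

text \<open>The control qubit goes to node 1 and the other qubits, in order, to nodes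
  \<open>2, \<dots>, n - 1\<close>.\<close>

definition distributed_state :: "nat \<Rightarrow> real vec \<Rightarrow> complex mat" where
  "distributed_state n \<theta> =
     fold (\<lambda>j. bit_flip (X_at n j) (\<theta> $ j)) [1..<n] (intermediate_state n \<theta>)"

definition bitstrings :: "nat \<Rightarrow> (nat \<Rightarrow> nat) set" where
  "bitstrings n = {1..<n} \<rightarrow>\<^sub>E {0, 1}"

definition basis_projector :: "nat \<Rightarrow> (nat \<Rightarrow> nat) \<Rightarrow> complex mat" where
  "basis_projector n s = node_op n (\<lambda>j. ketbra (s j) (s j))"

definition alpha :: "nat \<Rightarrow> real vec \<Rightarrow> (nat \<Rightarrow> nat) \<Rightarrow> real" where
  "alpha n \<theta> s =
     \<theta> $ 0 * (\<Prod>j\<in>{j\<in>{1..<n}. s j = 0}. \<theta> $ j) * (\<Prod>j\<in>{j\<in>{1..<n}. s j = 1}. 1 - \<theta> $ j)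
   + (1 - \<theta> $ 0) * (\<Prod>j\<in>{j\<in>{1..<n}. s j = 1}. \<theta> $ j) * (\<Prod>j\<in>{j\<in>{1..<n}. s j = 0}. 1 - \<theta> $ j)"


section \<open>Measurement outcomes\<close>

text \<open>Born rule for measuring the qubits of the nodes in \<open>J\<close> in the \<open>Z\<close> basis: the probability
  that the outcome at each \<open>j \<in> J\<close> is \<open>b j\<close>.\<close>

definition outcome_prob :: "nat \<Rightarrow> complex mat \<Rightarrow> nat set \<Rightarrow> (nat \<Rightarrow> nat) \<Rightarrow> real" where
  "outcome_prob n \<rho> J b =
     Re (trace (node_op n (\<lambda>j. if j \<in> J then ketbra (b j) (b j) else 1\<^sub>m 2) * \<rho>))"

definition prob1 :: "nat \<Rightarrow> real vec \<Rightarrow> nat \<Rightarrow> real" where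
  "prob1 n \<theta> j = outcome_prob n (distributed_state n \<theta>) {j} (\<lambda>_. 1)"

definition prob2 :: "nat \<Rightarrow> real vec \<Rightarrow> nat \<Rightarrow> nat \<Rightarrow> real" where
  "prob2 n \<theta> j k = outcome_prob n (distributed_state n \<theta>) {j, k} (\<lambda>_. 1)"

definition node_pairs :: "nat \<Rightarrow> (nat \<times> nat) set" where
  "node_pairs n = {(j, k). j \<in> {1..<n} \<and> k \<in> {1..<n} \<and> j \<noteq> k}"


section \<open>Estimators\<close>

text \<open>Below, \<open>p j\<close> and \<open>pp j k\<close> are either the exact probabilities or arbitrary estimates of
  them.\<close>

definition coeff_a :: "(nat \<Rightarrow> real) \<Rightarrow> (nat \<Rightarrow> nat \<Rightarrow> real) \<Rightarrow> nat \<Rightarrow> nat \<Rightarrow> real" where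
  "coeff_a p pp j k = 1 + 4 * pp j k - 2 * (p j + p k)"

definition coeff_c :: "(nat \<Rightarrow> real) \<Rightarrow> (nat \<Rightarrow> nat \<Rightarrow> real) \<Rightarrow> nat \<Rightarrow> nat \<Rightarrow> real" where
  "coeff_c p pp j k = p j * p k - pp j k"

definition root_eq :: "(nat \<Rightarrow> real) \<Rightarrow> (nat \<Rightarrow> nat \<Rightarrow> real) \<Rightarrow> nat \<Rightarrow> nat \<Rightarrow> real \<Rightarrow> bool" where
  "root_eq p pp j k x \<longleftrightarrow> coeff_a p pp j k * (1 - x) * x + coeff_c p pp j k = 0"

text \<open>The vectors that solve the equations for \<open>p 1, \<dots>, p (n - 1)\<close> together with the quadratic
  equations of the pairs in \<open>P\<close>.\<close>

definition solutions ::
    "nat \<Rightarrow> (nat \<times> nat) set \<Rightarrow> (nat \<Rightarrow> real) \<Rightarrow> (nat \<Rightarrow> nat \<Rightarrow> real) \<Rightarrow> real vec set" where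
  "solutions n P p pp =
     {v \<in> carrier_vec n.
        (\<forall>j\<in>{1..<n}. p j = v $ 0 * (1 - v $ j) + (1 - v $ 0) * v $ j) \<and>
        (\<forall>(j, k)\<in>P. root_eq p pp j k (v $ 0))}"

definition estimate :: "nat \<Rightarrow> (nat \<Rightarrow> real) \<Rightarrow> real \<Rightarrow> real vec" where
  "estimate n p x = vec n (\<lambda>j. if j = 0 then x else (p j - x) / (1 - 2 * x))"

definition identified :: "real vec set \<Rightarrow> bool" where
  "identified S \<longleftrightarrow> (\<exists>!v. v \<in> S)"

definition low_noise :: "real vec set" where
  "low_noise = {v. v $ 0 > 1 / 2}"

definition high_noise :: "real vec set" where
  "high_noise = {v. v $ 0 < 1 / 2}"

text \<open>The vectors of channel parameters that predict the same one- and two-node statistics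
  as \<open>\<theta>\<close>.\<close>

definition compatible :: "nat \<Rightarrow> real vec \<Rightarrow> real vec set" where
  "compatible n \<theta> =
     {v \<in> parameters n.
        (\<forall>j\<in>{1..<n}. prob1 n v j = prob1 n \<theta> j) \<and>
        (\<forall>(j, k)\<in>node_pairs n. prob2 n v j k = prob2 n \<theta> j k)}"

definition flipped :: "nat \<Rightarrow> real vec \<Rightarrow> real vec" where
  "flipped n \<theta> = vec n (\<lambda>j. 1 - \<theta> $ j)"

end

theory Submission
  imports Defs
begin

text \<open>Conjugation by \<open>Pauli_X\<close> at one node changes only that node's tensor factor, and a product
  operator is linear in each factor. Hence the process keeps the state a mixture, with weights
  \<open>\<theta>\<^sub>0\<close> and \<open>1 - \<theta>\<^sub>0\<close>, of two product operators with the diagonal factors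
  \<open>diag(\<theta>\<^sub>j, 1 - \<theta>\<^sub>j)\<close> and \<open>diag(1 - \<theta>\<^sub>j, \<theta>\<^sub>j)\<close>; the expansion and the
  outcome probabilities are products over the nodes.

  Given a root other than \<open>1 / 2\<close>, the equations for the \<open>p\<^sub>j\<close> are linear in the other parameters
  and determine them. All equations are invariant under \<open>\<theta> \<mapsto> 1 - \<theta>\<close>, whose only fixed point has
  \<open>\<theta>\<^sub>0 = 1 / 2\<close>, where those linear equations degenerate; so a solution is never unique.\<close>

section \<open>Tensor products\<close>

text \<open>Each \<open>k < a * b\<close> is \<open>i * b + j\<close> for exactly one
  \<open>i < a\<close> and one \<open>j < b\<close>, so summing over \<open>k\<close> is summing
  over pairs of digits. Matrix products and traces of Kronecker products both reduce to
  this.\<close>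

lemma sum_div_mod:
  fixes f g :: "nat \<Rightarrow> 'a::comm_semiring_0"
  shows "(\<Sum>k<a * b. f (k div b) * g (k mod b)) = (\<Sum>i<a. f i) * (\<Sum>j<b. g j)"
proof -
  have "(\<Sum>k<a * b. f (k div b) * g (k mod b))
      = (\<Sum>i<a. \<Sum>k\<in>{i * b..<i * b + b}. f (k div b) * g (k mod b))"
    by (rule sum.nat_group [symmetric])
  also have "\<dots> = (\<Sum>i<a. \<Sum>j<b. f i * g j)"
  proof (rule sum.cong [OF refl])
    fix i
    have "(\<Sum>k\<in>{i * b..<i * b + b}. f (k div b) * g (k mod b))
        = (\<Sum>j\<in>{0..<b}. f ((j + i * b) div b) * g ((j + i * b) mod b))"
      using sum.shift_bounds_nat_ivl [of "\<lambda>k. f (k div b) * g (k mod b)" 0 "i * b" b]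
      by (simp add: add.commute)
    also have "\<dots> = (\<Sum>j<b. f i * g j)"
      by (rule sum.cong) auto
    finally show "(\<Sum>k\<in>{i * b..<i * b + b}. f (k div b) * g (k mod b)) = (\<Sum>j<b. f i * g j)" .
  qed
  finally show ?thesis
    by (simp add: sum_product)
qed

lemma div_mod_less_mult:
  fixes i :: nat
  assumes "i < a * b"
  shows "i div b < a" "i mod b < b"
  using assms by (auto simp: less_mult_imp_div_less mult.commute intro!: mod_less_divisor gr0I)

lemma dim_tensor [simp]:
  "dim_row (A \<otimes>\<^sub>m B) = dim_row A * dim_row B"
  "dim_col (A \<otimes>\<^sub>m B) = dim_col A * dim_col B"
  by (simp_all add: tensor_def)

lemma index_tensor:
  assumes "i < dim_row A * dim_row B" "j < dim_col A * dim_col B"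
  shows "(A \<otimes>\<^sub>m B) $$ (i, j)
    = A $$ (i div dim_row B, j div dim_col B) * B $$ (i mod dim_row B, j mod dim_col B)"
  using assms by (simp add: tensor_def)

lemma tensor_carrier:
  assumes "A \<in> carrier_mat a a" "B \<in> carrier_mat b b"
  shows "A \<otimes>\<^sub>m B \<in> carrier_mat (a * b) (a * b)"
  using assms [THEN carrier_matD(1)] assms [THEN carrier_matD(2)] by (intro carrier_matI) simp_all

text \<open>The inner index of the matrix product splits into its quotient and remainder, one for
  each factor, and the sum factors by \<open>sum_div_mod\<close>.\<close>

lemma tensor_mult:
  assumes "dim_col A = dim_row C" "dim_col B = dim_row D"
  shows "(A \<otimes>\<^sub>m B) * (C \<otimes>\<^sub>m D) = (A * C) \<otimes>\<^sub>m (B * D)"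
proof (rule eq_matI)
  fix i j
  assume "i < dim_row ((A * C) \<otimes>\<^sub>m (B * D))" "j < dim_col ((A * C) \<otimes>\<^sub>m (B * D))"
  then have i: "i < dim_row A * dim_row B" and j: "j < dim_col C * dim_col D"
    by auto
  note ij = div_mod_less_mult [OF i] div_mod_less_mult [OF j]
  have "((A \<otimes>\<^sub>m B) * (C \<otimes>\<^sub>m D)) $$ (i, j)
      = (\<Sum>k<dim_row C * dim_row D.
          (A $$ (i div dim_row B, k div dim_row D) * C $$ (k div dim_row D, j div dim_col D)) *
          (B $$ (i mod dim_row B, k mod dim_row D) * D $$ (k mod dim_row D, j mod dim_col D)))"
    using i j assms by (auto simp: scalar_prod_def index_tensor atLeast0LessThan intro!: sum.cong)
  also have "\<dots> = (\<Sum>k<dim_row C. A $$ (i div dim_row B, k) * C $$ (k, j div dim_col D)) *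
      (\<Sum>k<dim_row D. B $$ (i mod dim_row B, k) * D $$ (k, j mod dim_col D))"
    by (rule sum_div_mod)
  also have "\<dots> = ((A * C) \<otimes>\<^sub>m (B * D)) $$ (i, j)"
    using i j ij assms by (simp add: index_tensor scalar_prod_def atLeast0LessThan)
  finally show "((A \<otimes>\<^sub>m B) * (C \<otimes>\<^sub>m D)) $$ (i, j) = ((A * C) \<otimes>\<^sub>m (B * D)) $$ (i, j)" .
qed auto

lemma trace_tensor:
  assumes "dim_row A = dim_col A" "dim_row B = dim_col B"
  shows "trace (A \<otimes>\<^sub>m B) = trace A * trace B"
  using sum_div_mod [of "\<lambda>i. A $$ (i, i)" "dim_row B" "\<lambda>i. B $$ (i, i)" "dim_row A"] assms
  by (simp add: trace_def index_tensor)

lemma tensor_smult_left: "(c \<cdot>\<^sub>m A) \<otimes>\<^sub>m B = c \<cdot>\<^sub>m (A \<otimes>\<^sub>m B)"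
  by (rule eq_matI) (auto simp: index_tensor div_mod_less_mult)

lemma dim_mat_adjoint [simp]:
  "dim_row (mat_adjoint A) = dim_col A" "dim_col (mat_adjoint A) = dim_row A"
  by (simp_all add: mat_adjoint_def)

lemma index_mat_adjoint:
  assumes "i < dim_col A" "j < dim_row A"
  shows "mat_adjoint A $$ (i, j) = conjugate (A $$ (j, i))"
  using assms by (simp add: mat_adjoint_def mat_of_rows_index)

lemma mat_adjoint_tensor: "mat_adjoint (A \<otimes>\<^sub>m B) = mat_adjoint A \<otimes>\<^sub>m mat_adjoint B"
  by (rule eq_matI) (auto simp: index_mat_adjoint index_tensor div_mod_less_mult)

lemma mat_adjoint_add:
  assumes "A \<in> carrier_mat nr nc" "B \<in> carrier_mat nr nc"
  shows "mat_adjoint (A + B) = mat_adjoint A + mat_adjoint (B :: complex mat)"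
  using assms by (intro eq_matI) (auto simp: index_mat_adjoint)

section \<open>Iterated tensor products\<close>

lemma tensors_Nil [simp]: "tensors [] = 1\<^sub>m 1"
  by (simp add: tensors_def)

lemma tensors_Cons [simp]: "tensors (A # As) = A \<otimes>\<^sub>m tensors As"
  by (simp add: tensors_def)

lemma tensors_carrier:
  assumes "\<And>j. j \<in> set js \<Longrightarrow> A j \<in> carrier_mat d d"
  shows "tensors (map A js) \<in> carrier_mat (d ^ length js) (d ^ length js)"
  using assms
proof (induction js)
  case (Cons j js)
  have "A j \<in> carrier_mat d d" "tensors (map A js) \<in> carrier_mat (d ^ length js) (d ^ length js)"
    by (rule Cons.prems, simp, rule Cons.IH [OF Cons.prems], simp)
  note dims = this [THEN carrier_matD(1)] this [THEN carrier_matD(2)]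
  show ?case
    by (rule carrier_matI) (simp_all add: dims)
qed simp

lemma tensors_mult:
  assumes "\<And>j. j \<in> set js \<Longrightarrow> A j \<in> carrier_mat d d" "\<And>j. j \<in> set js \<Longrightarrow> B j \<in> carrier_mat d d"
  shows "tensors (map A js) * tensors (map B js) = tensors (map (\<lambda>j. A j * B j) js)"
  using assms
proof (induction js)
  case (Cons j js)
  have "tensors (map A js) \<in> carrier_mat (d ^ length js) (d ^ length js)"
    "tensors (map B js) \<in> carrier_mat (d ^ length js) (d ^ length js)"
    "A j \<in> carrier_mat d d" "B j \<in> carrier_mat d d"
    using Cons.prems by (auto intro!: tensors_carrier)
  note dims = this [THEN carrier_matD(1)] this [THEN carrier_matD(2)]
  show ?case
    using Cons by (simp add: tensor_mult dims)
qed simp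

lemma mat_adjoint_tensors: "mat_adjoint (tensors As) = tensors (map mat_adjoint As)"
proof (induction As)
  case Nil
  show ?case by (rule eq_matI) (auto simp: index_mat_adjoint)
qed (simp add: mat_adjoint_tensor)

lemma trace_tensors:
  assumes "\<And>j. j \<in> set js \<Longrightarrow> A j \<in> carrier_mat d d"
  shows "trace (tensors (map A js)) = (\<Prod>j\<leftarrow>js. trace (A j))"
  using assms
proof (induction js)
  case Nil
  show ?case by (simp add: trace_def)
next
  case (Cons j js)
  have "A j \<in> carrier_mat d d" "tensors (map A js) \<in> carrier_mat (d ^ length js) (d ^ length js)"
    using Cons.prems by (auto intro!: tensors_carrier)
  note dims = this [THEN carrier_matD(1)] this [THEN carrier_matD(2)]
  show ?case
    using Cons by (simp add: trace_tensor dims)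
qed

text \<open>The digits of the row and column number are functions of the tensor factor that do not depend
  on the matrices; this makes a product of operators multilinear by the distributivity of
  products of numbers.\<close>

lemma tensors_entry:
  assumes "distinct js" "r < d ^ length js" "c < d ^ length js"
  shows "\<exists>x y. (\<forall>j\<in>set js. x j < d \<and> y j < d) \<and>
    (\<forall>A. (\<forall>j\<in>set js. A j \<in> carrier_mat d d) \<longrightarrow>
      tensors (map A js) $$ (r, c) = (\<Prod>j\<in>set js. A j $$ (x j, y j)))"
  using assms
proof (induction js arbitrary: r c)
  case Nil
  then show ?case by simp
next
  case (Cons i js)
  let ?N = "d ^ length js"
  have r: "r div ?N < d" "r mod ?N < ?N" and c: "c div ?N < d" "c mod ?N < ?N"
    by (rule div_mod_less_mult, use Cons.prems in simp)+
  have "distinct js"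
    using Cons.prems by simp
  from Cons.IH [OF this r(2) c(2)]
  obtain x y where xy: "\<forall>j\<in>set js. x j < d \<and> y j < d"
    and entry: "\<forall>A. (\<forall>j\<in>set js. A j \<in> carrier_mat d d) \<longrightarrow>
      tensors (map A js) $$ (r mod ?N, c mod ?N) = (\<Prod>j\<in>set js. A j $$ (x j, y j))"
    by (elim exE conjE) (rule that)
  have i: "i \<notin> set js"
    using Cons.prems by simp
  \<comment> \<open>The leading digits of \<open>r\<close> and \<open>c\<close> select the entry of
    the head factor. Distinctness of the list ensures that these updates do not disturb the digits
    chosen for the tail.\<close>
  define x' y' where "x' = x(i := r div ?N)" and "y' = y(i := c div ?N)"
  have "tensors (map A (i # js)) $$ (r, c) = (\<Prod>j\<in>set (i # js). A j $$ (x' j, y' j))"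
    if A: "\<forall>j\<in>set (i # js). A j \<in> carrier_mat d d" for A
  proof -
    have "tensors (map A js) \<in> carrier_mat ?N ?N"
      using A by (intro tensors_carrier) auto
    note dims = carrier_matD [OF this]
    have "A i \<in> carrier_mat d d"
      using A by simp
    note dims' = carrier_matD [OF this]
    have "tensors (map A (i # js)) $$ (r, c)
        = A i $$ (r div ?N, c div ?N) * tensors (map A js) $$ (r mod ?N, c mod ?N)"
      using Cons.prems(2,3) by (simp add: index_tensor dims dims')
    also have "tensors (map A js) $$ (r mod ?N, c mod ?N) = (\<Prod>j\<in>set js. A j $$ (x j, y j))"
      using A by (intro entry [rule_format]) simp
    also have "\<dots> = (\<Prod>j\<in>set js. A j $$ (x' j, y' j))"
      using i by (intro prod.cong) (auto simp: x'_def y'_def)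
    finally show ?thesis
      using i by (simp add: x'_def y'_def)
  qed
  moreover have "\<forall>j\<in>set (i # js). x' j < d \<and> y' j < d"
    using xy r c by (simp add: x'_def y'_def)
  ultimately show ?case
    by blast
qed

text \<open>Reduces the algebraic \<open>finsum\<close> over the module of matrices to ordinary sums
  of entries, so that an expansion of the state can be checked entry by entry.\<close>

lemma module_mat_finsum:
  assumes "finite S" "\<And>s. s \<in> S \<Longrightarrow> f s \<in> carrier_mat nr nc"
  defines "R \<equiv> module_mat TYPE('a::comm_ring_1) nr nc"
  shows "finsum R f S \<in> carrier_mat nr nc"
    and "r < nr \<Longrightarrow> c < nc \<Longrightarrow> finsum R f S $$ (r, c) = (\<Sum>s\<in>S. f s $$ (r, c))"
proof -
  interpret abelian_group R
    unfolding R_def by (rule abelian_group_mat)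
  have carrier: "carrier R = carrier_mat nr nc"
    by (simp add: R_def module_mat_simps)
  then show "finsum R f S \<in> carrier_mat nr nc"
    using finsum_closed [of f S] assms by auto
  show "finsum R f S $$ (r, c) = (\<Sum>s\<in>S. f s $$ (r, c))" if "r < nr" "c < nc"
    using assms(1,2)
  proof (induction S)
    case empty
    show ?case
      unfolding finsum_empty using that by (simp add: R_def module_mat_simps)
  next
    case (insert s S)
    then have f: "f \<in> S \<rightarrow> carrier R" "f s \<in> carrier R"
      by (auto simp: carrier)
    have "finsum R f (insert s S) = f s \<oplus>\<^bsub>R\<^esub> finsum R f S"
      by (rule finsum_insert [OF insert.hyps f])
    moreover have "finsum R f S \<in> carrier_mat nr nc"
      using finsum_closed [OF f(1)] by (simp add: carrier)
    ultimately show ?case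
      using that insert by (simp add: R_def module_mat_simps)
  qed
qed

lemma trace_lincomb:
  assumes "A \<in> carrier_mat m m" "B \<in> carrier_mat m m"
  shows "trace (a \<cdot>\<^sub>m A + b \<cdot>\<^sub>m B) = a * trace A + b * trace B"
  using assms by (simp add: trace_def sum.distrib sum_distrib_left)

section \<open>Product operators and bit flips\<close>

lemma node_op_carrier:
  assumes "\<And>j. A j \<in> carrier_mat 2 2"
  shows "node_op n A \<in> carrier_mat (2 ^ (n - 1)) (2 ^ (n - 1))"
  using tensors_carrier [of "[1..<n]" A 2] assms by (simp add: node_op_def)

lemma node_op_mult:
  assumes "\<And>j. A j \<in> carrier_mat 2 2" "\<And>j. B j \<in> carrier_mat 2 2"
  shows "node_op n A * node_op n B = node_op n (\<lambda>j. A j * B j)"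
  unfolding node_op_def by (rule tensors_mult) (rule assms)+

lemma trace_node_op:
  assumes "\<And>j. A j \<in> carrier_mat 2 2"
  shows "trace (node_op n A) = (\<Prod>j\<in>{1..<n}. trace (A j))"
proof -
  have "trace (node_op n A) = (\<Prod>j\<leftarrow>[1..<n]. trace (A j))"
    unfolding node_op_def by (rule trace_tensors) (rule assms)
  then show ?thesis
    using prod.distinct_set_conv_list [of "[1..<n]" "\<lambda>j. trace (A j)"] by simp
qed

lemma node_op_entry:
  assumes "r < 2 ^ (n - 1)" "c < 2 ^ (n - 1)"
  shows "\<exists>x y. (\<forall>j\<in>{1..<n}. x j < 2 \<and> y j < 2) \<and>
    (\<forall>A. (\<forall>j\<in>{1..<n}. A j \<in> carrier_mat 2 2) \<longrightarrow>
      node_op n A $$ (r, c) = (\<Prod>j\<in>{1..<n}. A j $$ (x j, y j)))"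
  using tensors_entry [of "[1..<n]" r 2 c] assms by (simp add: node_op_def)

text \<open>By \<open>node_op_entry\<close> an entry is a product of one number per node, with
  digits independent of the operators. The factor of node \<open>j\<close> can be pulled out, and
  the remaining product is the same in all three terms.\<close>

lemma node_op_upd_lincomb:
  assumes j: "j \<in> {1..<n}" and A: "\<And>i. A i \<in> carrier_mat 2 2"
    and M: "M \<in> carrier_mat 2 2" and N: "N \<in> carrier_mat 2 2"
  shows "node_op n (A(j := a \<cdot>\<^sub>m M + b \<cdot>\<^sub>m N))
    = a \<cdot>\<^sub>m node_op n (A(j := M)) + b \<cdot>\<^sub>m node_op n (A(j := N))" (is "?L = ?R")
proof (rule eq_matI)
  have upd: "(A(j := K)) i \<in> carrier_mat 2 2" if "K \<in> carrier_mat 2 2" for K i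
    using A that by simp
  have MN: "a \<cdot>\<^sub>m M + b \<cdot>\<^sub>m N \<in> carrier_mat 2 2"
    using M N by simp
  note dims = node_op_carrier [OF upd [OF M], of n] node_op_carrier [OF upd [OF N], of n]
    node_op_carrier [OF upd [OF MN], of n]
  note dims' = dims [THEN carrier_matD(1)] dims [THEN carrier_matD(2)]
  show "dim_row ?L = dim_row ?R" "dim_col ?L = dim_col ?R"
    by (simp_all add: dims')
  fix r c
  assume "r < dim_row ?R" "c < dim_col ?R"
  then have r: "r < 2 ^ (n - 1)" and c: "c < 2 ^ (n - 1)"
    by (simp_all add: dims')
  obtain x y where xy: "\<forall>j\<in>{1..<n}. x j < 2 \<and> y j < 2"
    and entry: "\<forall>A. (\<forall>j\<in>{1..<n}. A j \<in> carrier_mat 2 2) \<longrightarrow>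
      node_op n A $$ (r, c) = (\<Prod>j\<in>{1..<n}. A j $$ (x j, y j))"
    using node_op_entry [OF r c] by (elim exE conjE) (rule that)
  have split: "node_op n (A(j := K)) $$ (r, c)
      = K $$ (x j, y j) * (\<Prod>i\<in>{1..<n} - {j}. A i $$ (x i, y i))"
    if "K \<in> carrier_mat 2 2" for K
  proof -
    have "node_op n (A(j := K)) $$ (r, c) = (\<Prod>i\<in>{1..<n}. (A(j := K)) i $$ (x i, y i))"
      by (rule entry [rule_format]) (rule upd [OF that])
    also have "\<dots> = K $$ (x j, y j) * (\<Prod>i\<in>{1..<n} - {j}. (A(j := K)) i $$ (x i, y i))"
      using j by (subst prod.remove [of _ j]) auto
    also have "(\<Prod>i\<in>{1..<n} - {j}. (A(j := K)) i $$ (x i, y i))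
        = (\<Prod>i\<in>{1..<n} - {j}. A i $$ (x i, y i))"
      by (rule prod.cong) auto
    finally show ?thesis .
  qed
  have "x j < 2" "y j < 2"
    using xy j by simp_all
  then show "?L $$ (r, c) = ?R $$ (r, c)"
    using r c M N by (simp add: split [OF MN] split [OF M] split [OF N] dims' algebra_simps)
qed

lemma bit_flip_carrier:
  assumes "V \<in> carrier_mat m m" "M \<in> carrier_mat m m"
  shows "bit_flip V t M \<in> carrier_mat m m"
  using assms by (simp add: bit_flip_def)

lemma bit_flip_lincomb:
  assumes V: "V \<in> carrier_mat m m" and M: "M \<in> carrier_mat m m" and N: "N \<in> carrier_mat m m"
  shows "bit_flip V t (a \<cdot>\<^sub>m M + b \<cdot>\<^sub>m N) = a \<cdot>\<^sub>m bit_flip V t M + b \<cdot>\<^sub>m bit_flip V t N"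
proof -
  have "V * (a \<cdot>\<^sub>m M + b \<cdot>\<^sub>m N) = a \<cdot>\<^sub>m (V * M) + b \<cdot>\<^sub>m (V * N)"
    using V M N by (simp add: mult_add_distrib_mat [of _ m m _ m] mult_smult_distrib [of _ m m _ m])
  then have "V * (a \<cdot>\<^sub>m M + b \<cdot>\<^sub>m N) * V = a \<cdot>\<^sub>m (V * M * V) + b \<cdot>\<^sub>m (V * N * V)"
    using V M N
    by (simp add: add_mult_distrib_mat [of _ m m _ _ m] mult_smult_assoc_mat [of _ m m _ m])
  then show ?thesis
    using V M N by (intro eq_matI) (auto simp: bit_flip_def algebra_simps)
qed

lemma Pauli_X_carrier [simp]: "Pauli_X \<in> carrier_mat 2 2"
  by (rule carrier_matI) (simp_all add: Pauli_X_def mat_of_rows_list_def)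

lemma ketbra_carrier [simp]: "ketbra a b \<in> carrier_mat 2 2"
  by (simp add: ketbra_def)

lemma X_at_carrier: "X_at n j \<in> carrier_mat (2 ^ (n - 1)) (2 ^ (n - 1))"
  unfolding X_at_def by (rule node_op_carrier) simp

text \<open>At every node other than \<open>j\<close> the conjugation is by the identity. The two
  branches of the channel are therefore product operators that differ only at \<open>j\<close>, and
  multilinearity merges them into a single product operator.\<close>

lemma bit_flip_X_at:
  assumes j: "j \<in> {1..<n}" and A: "\<And>i. A i \<in> carrier_mat 2 2"
  shows "bit_flip (X_at n j) t (node_op n A) = node_op n (A(j := bit_flip Pauli_X t (A j)))"
proof -
  let ?V = "\<lambda>i. if i = j then Pauli_X else 1\<^sub>m 2"
  have V: "?V i \<in> carrier_mat 2 2" for i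
    by simp
  have "?V i * A i \<in> carrier_mat 2 2" for i
    using mult_carrier_mat [OF V A] .
  then have "X_at n j * node_op n A * X_at n j = node_op n (\<lambda>i. ?V i * A i * ?V i)"
    by (simp only: X_at_def node_op_mult [OF V A] node_op_mult [OF _ V])
  also have "(\<lambda>i. ?V i * A i * ?V i) = A(j := Pauli_X * A j * Pauli_X)"
    using A left_mult_one_mat [OF A] right_mult_one_mat [OF A] by (intro ext) simp
  finally have conj: "X_at n j * node_op n A * X_at n j
      = node_op n (A(j := Pauli_X * A j * Pauli_X))" .
  \<comment> \<open>The first branch is written with the trivial update \<open>A(j := A j)\<close>
    so that both branches have the shape required by \<open>node_op_upd_lincomb\<close>.\<close>
  have "bit_flip (X_at n j) t (node_op n A)
      = complex_of_real t \<cdot>\<^sub>m node_op n (A(j := A j))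
      + complex_of_real (1 - t) \<cdot>\<^sub>m node_op n (A(j := Pauli_X * A j * Pauli_X))"
    by (simp only: bit_flip_def conj fun_upd_triv)
  also have "\<dots> = node_op n (A(j := bit_flip Pauli_X t (A j)))"
    unfolding bit_flip_def using A j
    by (intro node_op_upd_lincomb [symmetric]) (auto intro!: mult_carrier_mat [of _ 2 2])
  finally show ?thesis .
qed

text \<open>Since \<open>js\<close> is distinct, each listed node meets exactly one channel, which
  acts on its original factor. The induction varies \<open>A\<close> and \<open>B\<close> because
  each channel replaces them by updated families.\<close>

lemma fold_bit_flip_X_at:
  assumes "distinct js" "set js \<subseteq> {1..<n}"
    and "\<And>i. A i \<in> carrier_mat 2 2" "\<And>i. B i \<in> carrier_mat 2 2"
  shows "fold (\<lambda>j. bit_flip (X_at n j) (t j)) js (a \<cdot>\<^sub>m node_op n A + b \<cdot>\<^sub>m node_op n B)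
    = a \<cdot>\<^sub>m node_op n (\<lambda>i. if i \<in> set js then bit_flip Pauli_X (t i) (A i) else A i)
    + b \<cdot>\<^sub>m node_op n (\<lambda>i. if i \<in> set js then bit_flip Pauli_X (t i) (B i) else B i)"
  using assms
proof (induction js arbitrary: A B)
  case (Cons j js)
  let ?upd = "\<lambda>A. A(j := bit_flip Pauli_X (t j) (A j))"
  have j: "j \<in> {1..<n}" and js: "distinct js" "set js \<subseteq> {1..<n}" and "j \<notin> set js"
    using Cons.prems(1,2) by auto
  have upd: "?upd A i \<in> carrier_mat 2 2" "?upd B i \<in> carrier_mat 2 2" for i
    using Cons.prems(3,4) by (simp_all add: bit_flip_carrier)
  have eq: "(\<lambda>i. if i \<in> set js then bit_flip Pauli_X (t i) (?upd K i) else ?upd K i)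
      = (\<lambda>i. if i \<in> set (j # js) then bit_flip Pauli_X (t i) (K i) else K i)" for K
    using \<open>j \<notin> set js\<close> by auto
  have "bit_flip (X_at n j) (t j) (a \<cdot>\<^sub>m node_op n A + b \<cdot>\<^sub>m node_op n B)
      = a \<cdot>\<^sub>m node_op n (?upd A) + b \<cdot>\<^sub>m node_op n (?upd B)"
    by (simp only: bit_flip_lincomb [OF X_at_carrier node_op_carrier node_op_carrier]
        Cons.prems(3,4) bit_flip_X_at [OF j])
  then show ?case
    using Cons.IH [OF js upd] by (simp only: fold_Cons o_apply eq)
qed simp

text \<open>Both basis projectors and the identity are diagonal, and bit flips preserve diagonality:
  conjugation by \<open>Pauli_X\<close> swaps the two diagonal entries. Calculations on one qubit
  thus become calculations with pairs of numbers.\<close>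

definition qubit_diag :: "complex \<Rightarrow> complex \<Rightarrow> complex mat" where
  "qubit_diag a b = mat 2 2 (\<lambda>(i, j). if i = j then if i = 0 then a else b else 0)"

lemma qubit_diag_carrier [simp]: "qubit_diag a b \<in> carrier_mat 2 2"
  by (simp add: qubit_diag_def)

lemma index_Pauli_X: "i < 2 \<Longrightarrow> j < 2 \<Longrightarrow> Pauli_X $$ (i, j) = (if i = j then 0 else 1)"
  by (auto simp: Pauli_X_def mat_of_rows_list_def less_2_cases_iff)

lemma ketbra_eq_qubit_diag: "ketbra 0 0 = qubit_diag 1 0" "ketbra 1 1 = qubit_diag 0 1"
  by (auto simp: ketbra_def qubit_diag_def less_2_cases_iff)

lemma one_mat_eq_qubit_diag: "1\<^sub>m 2 = qubit_diag 1 1"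
  by (rule eq_matI) (auto simp: qubit_diag_def)

lemma qubit_diag_mult: "qubit_diag a b * qubit_diag c d = qubit_diag (a * c) (b * d)"
  by (rule eq_matI) (auto simp: qubit_diag_def scalar_prod_def less_2_cases_iff numeral_2_eq_2)

lemma Pauli_X_mult_qubit_diag_mult: "Pauli_X * qubit_diag a b * Pauli_X = qubit_diag b a"
proof (rule eq_matI)
  fix i j
  assume "i < dim_row (qubit_diag b a)" "j < dim_col (qubit_diag b a)"
  then have "i < 2" "j < 2"
    by (simp_all add: qubit_diag_def)
  then show "(Pauli_X * qubit_diag a b * Pauli_X) $$ (i, j) = qubit_diag b a $$ (i, j)"
    using Pauli_X_carrier [THEN carrier_matD(1)] Pauli_X_carrier [THEN carrier_matD(2)]
    by (auto simp: qubit_diag_def scalar_prod_def index_Pauli_X less_2_cases_iff numeral_2_eq_2)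
qed (simp_all add: qubit_diag_def Pauli_X_carrier [THEN carrier_matD(1)] Pauli_X_carrier [THEN carrier_matD(2)])

lemma qubit_diag_lincomb:
  "x \<cdot>\<^sub>m qubit_diag a b + y \<cdot>\<^sub>m qubit_diag c d = qubit_diag (x * a + y * c) (x * b + y * d)"
  by (rule eq_matI) (auto simp: qubit_diag_def)

lemma trace_qubit_diag: "trace (qubit_diag a b) = a + b"
  by (simp add: trace_def qubit_diag_def numeral_2_eq_2)

lemma bit_flip_qubit_diag:
  "bit_flip Pauli_X t (qubit_diag a b)
    = qubit_diag (of_real t * a + of_real (1 - t) * b) (of_real t * b + of_real (1 - t) * a)"
  by (simp only: bit_flip_def Pauli_X_mult_qubit_diag_mult qubit_diag_lincomb)

lemma mat_adjoint_Pauli_X: "mat_adjoint Pauli_X = Pauli_X"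
  using Pauli_X_carrier [THEN carrier_matD(1)] Pauli_X_carrier [THEN carrier_matD(2)]
  by (intro eq_matI) (auto simp: index_mat_adjoint index_Pauli_X)

lemma mat_adjoint_ketbra: "mat_adjoint (ketbra a a) = ketbra a a"
  by (rule eq_matI) (auto simp: index_mat_adjoint ketbra_def)

lemma mat_adjoint_one: "mat_adjoint (1\<^sub>m m :: complex mat) = 1\<^sub>m m"
  by (rule eq_matI) (auto simp: index_mat_adjoint)

section \<open>The distributed state\<close>

text \<open>The root channel leaves the control qubit diagonal, so there is no coherence between its
  two values. The gate then merely copies a classical bit into the register, and the mixed terms
  contain a product of orthogonal projectors.\<close>

lemma intermediate_state_eq:
  assumes n: "n \<ge> 2"
  shows "intermediate_state n \<theta>
    = complex_of_real (\<theta> $ 0) \<cdot>\<^sub>m node_op n (\<lambda>_. ketbra 0 0)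
    + complex_of_real (1 - \<theta> $ 0) \<cdot>\<^sub>m node_op n (\<lambda>_. ketbra 1 1)"
proof -
  define N where "N = (2::nat) ^ (n - 2)"
  \<comment> \<open>\<open>T M\<close> puts \<open>M\<close> on each of the nodes from 2 on. As
    \<open>n \<ge> 2\<close>, the node list starts with 1, and \<open>node_op\<close> splits into
    the control factor and \<open>T\<close>.\<close>
  define T where "T M = tensors (map (\<lambda>_. M) [2..<n])" for M
  define K0 where "K0 = qubit_diag 1 0"
  define K1 where "K1 = qubit_diag 0 1"
  define a where "a = complex_of_real (\<theta> $ 0)"
  define b where "b = complex_of_real (1 - \<theta> $ 0)"
  note K = K0_def K1_def
  have replicate: "tensors (replicate (n - 2) M) = T M" for M
    by (simp add: T_def map_replicate_const)
  have T: "T M \<in> carrier_mat N N" if "M \<in> carrier_mat 2 2" for M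
    using tensors_carrier [of "[2..<n]" "\<lambda>_. M" 2] that by (simp add: T_def N_def)
  have T_mult: "T M * T M' = T (M * M')" if "M \<in> carrier_mat 2 2" "M' \<in> carrier_mat 2 2" for M M'
    unfolding T_def by (rule tensors_mult) (rule that)+
  have node_op: "node_op n (\<lambda>_. M) = M \<otimes>\<^sub>m T M" for M
    using n by (simp add: node_op_def T_def upt_conv_Cons numeral_2_eq_2)
  have K_carrier [simp]: "K0 \<in> carrier_mat 2 2" "K1 \<in> carrier_mat 2 2"
    by (simp_all add: K)
  have one_carrier: "1\<^sub>m 2 \<in> carrier_mat 2 2"
    by simp
  define \<sigma> where "\<sigma> = qubit_diag a b"
  have \<sigma>: "bit_flip Pauli_X (\<theta> $ 0) (ketbra 0 0) = \<sigma>"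
    by (simp add: ketbra_eq_qubit_diag bit_flip_qubit_diag a_def b_def \<sigma>_def)
  have \<sigma>_carrier: "\<sigma> \<in> carrier_mat 2 2"
    by (simp add: \<sigma>_def)
  define F where "F = K0 \<otimes>\<^sub>m T (1\<^sub>m 2) + K1 \<otimes>\<^sub>m T Pauli_X"
  have fanout: "fanout n = F"
    by (simp only: fanout_def F_def replicate ketbra_eq_qubit_diag K)
  have FA: "K0 \<otimes>\<^sub>m T (1\<^sub>m 2) \<in> carrier_mat (2 * N) (2 * N)"
    and FB: "K1 \<otimes>\<^sub>m T Pauli_X \<in> carrier_mat (2 * N) (2 * N)"
    by (rule tensor_carrier; simp add: T)+
  have adjoint: "mat_adjoint F = F"
    unfolding F_def mat_adjoint_add [OF FA FB]
    using mat_adjoint_ketbra [of 0] mat_adjoint_ketbra [of 1]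
    by (simp add: mat_adjoint_tensor T_def mat_adjoint_tensors mat_adjoint_Pauli_X
        mat_adjoint_one K ketbra_eq_qubit_diag [symmetric] comp_def)
  have prod: "(A \<otimes>\<^sub>m T M) * (B \<otimes>\<^sub>m T M') = (A * B) \<otimes>\<^sub>m T (M * M')"
    if "A \<in> carrier_mat 2 2" "B \<in> carrier_mat 2 2" "M \<in> carrier_mat 2 2" "M' \<in> carrier_mat 2 2"
    for A B M M'
  proof -
    note dims = that [THEN carrier_matD(1)] that [THEN carrier_matD(2)]
      T [OF that(3), THEN carrier_matD(2)] T [OF that(4), THEN carrier_matD(1)]
    show ?thesis
      by (simp add: tensor_mult dims T_mult [OF that(3,4)])
  qed
  have TP: "A \<otimes>\<^sub>m T M \<in> carrier_mat (2 * N) (2 * N)"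
    if "A \<in> carrier_mat 2 2" "M \<in> carrier_mat 2 2" for A M
    using that by (intro tensor_carrier T)
  \<comment> \<open>A vanishing control factor annihilates the whole product; this removes the mixed
    terms below.\<close>
  have zero: "qubit_diag 0 0 \<otimes>\<^sub>m T M = 0\<^sub>m (2 * N) (2 * N)" if "M \<in> carrier_mat 2 2" for M
  proof -
    have "qubit_diag 0 0 = 0\<^sub>m 2 2"
      by (rule eq_matI) (auto simp: qubit_diag_def)
    then show ?thesis
      using T [OF that, THEN carrier_matD(1)] T [OF that, THEN carrier_matD(2)]
      by (intro eq_matI) (auto simp: index_tensor div_mod_less_mult)
  qed
  have XK: "Pauli_X * K0 \<in> carrier_mat 2 2"
    by (rule mult_carrier_mat [of _ 2 2]) simp_all
  \<comment> \<open>Multiplication from the left separates the control values: 0 leaves the register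
    alone, 1 applies \<open>Pauli_X\<close> to it. Multiplication from the right then completes the
    conjugation, which turns \<open>K0\<close> into \<open>K1\<close> in the second term.\<close>
  have "F * (\<sigma> \<otimes>\<^sub>m T K0) = qubit_diag a 0 \<otimes>\<^sub>m T K0 + qubit_diag 0 b \<otimes>\<^sub>m T (Pauli_X * K0)"
    unfolding F_def add_mult_distrib_mat [OF FA FB TP [OF \<sigma>_carrier K_carrier(1)]]
    by (simp only: prod \<sigma>_carrier K_carrier one_carrier Pauli_X_carrier left_mult_one_mat [OF K_carrier(1)])
      (simp add: K \<sigma>_def qubit_diag_mult)
  also have "\<dots> * F = qubit_diag a 0 \<otimes>\<^sub>m T K0 + qubit_diag 0 b \<otimes>\<^sub>m T K1"
  proof -
    have XKX: "Pauli_X * K0 * Pauli_X = K1"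
      by (simp add: K Pauli_X_mult_qubit_diag_mult)
    have KX: "K0 * Pauli_X \<in> carrier_mat 2 2"
      by (rule mult_carrier_mat [of _ 2 2]) simp_all
    have 1: "qubit_diag a 0 \<otimes>\<^sub>m T K0 * F = qubit_diag a 0 \<otimes>\<^sub>m T K0"
      unfolding F_def mult_add_distrib_mat [OF TP [OF qubit_diag_carrier K_carrier(1)] FA FB]
      using TP [OF qubit_diag_carrier [of a 0] K_carrier(1)]
      by (simp only: prod qubit_diag_carrier K_carrier one_carrier Pauli_X_carrier
          right_mult_one_mat [OF K_carrier(1)])
        (simp add: K qubit_diag_mult zero KX [unfolded K])
    have 2: "qubit_diag 0 b \<otimes>\<^sub>m T (Pauli_X * K0) * F = qubit_diag 0 b \<otimes>\<^sub>m T K1"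
      unfolding F_def mult_add_distrib_mat [OF TP [OF qubit_diag_carrier XK] FA FB]
      using TP [OF qubit_diag_carrier [of 0 b] K_carrier(2)]
      by (simp only: prod qubit_diag_carrier K_carrier one_carrier Pauli_X_carrier XK XKX
          right_mult_one_mat [OF XK])
        (simp add: K qubit_diag_mult zero XK [unfolded K])
    have F: "F \<in> carrier_mat (2 * N) (2 * N)"
      using FA FB by (simp add: F_def)
    show ?thesis
      by (simp only: add_mult_distrib_mat [OF TP TP F] qubit_diag_carrier K_carrier XK 1 2)
  qed
  also have "qubit_diag a 0 = a \<cdot>\<^sub>m K0"
    by (rule eq_matI) (auto simp: K qubit_diag_def)
  also have "qubit_diag 0 b = b \<cdot>\<^sub>m K1"
    by (rule eq_matI) (auto simp: K qubit_diag_def)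
  finally have "F * (\<sigma> \<otimes>\<^sub>m T K0) * F = a \<cdot>\<^sub>m (K0 \<otimes>\<^sub>m T K0) + b \<cdot>\<^sub>m (K1 \<otimes>\<^sub>m T K1)"
    by (simp only: tensor_smult_left)
  moreover have "intermediate_state n \<theta> = F * (\<sigma> \<otimes>\<^sub>m T K0) * F"
    by (simp only: intermediate_state_def fanout adjoint \<sigma> replicate)
      (simp only: K ketbra_eq_qubit_diag)
  ultimately show ?thesis
    by (simp only: node_op ketbra_eq_qubit_diag K a_def b_def)
qed

lemma distributed_state_eq:
  assumes n: "n \<ge> 2"
  shows "distributed_state n \<theta>
    = complex_of_real (\<theta> $ 0) \<cdot>\<^sub>m
        node_op n (\<lambda>j. qubit_diag (of_real (\<theta> $ j)) (of_real (1 - \<theta> $ j)))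
    + complex_of_real (1 - \<theta> $ 0) \<cdot>\<^sub>m
        node_op n (\<lambda>j. qubit_diag (of_real (1 - \<theta> $ j)) (of_real (\<theta> $ j)))"
proof -
  \<comment> \<open>Factors outside \<open>{1..<n}\<close> are untouched by the channels, but
    \<open>node_op\<close> never reads them.\<close>
  have cong: "node_op n (\<lambda>i. if i \<in> {1..<n} then A i else B i) = node_op n A" for A B
    unfolding node_op_def by (intro arg_cong [where f = tensors] map_cong) auto
  show ?thesis
    unfolding distributed_state_def intermediate_state_eq [OF n]
    by (subst fold_bit_flip_X_at)
      (simp_all only: cong ketbra_eq_qubit_diag bit_flip_qubit_diag qubit_diag_carrier distinct_upt
        set_upt subset_refl mult_1_right mult_zero_right add_0_left add_0_right)
qed

section \<open>Expansion in the computational basis\<close>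

lemma finite_bitstrings: "finite (bitstrings n)"
  by (simp add: bitstrings_def finite_PiE)

text \<open>Each diagonal factor is a sum of two weighted projectors. Distributing the product over
  the nodes gives one term for every choice of a projector at each node, and such choices are the
  bit strings.\<close>

lemma node_op_qubit_diag_entry:
  assumes "r < 2 ^ (n - 1)" "c < 2 ^ (n - 1)"
  shows "node_op n (\<lambda>j. qubit_diag (u j) (v j)) $$ (r, c)
    = (\<Sum>s\<in>bitstrings n. (\<Prod>j\<in>{1..<n}. if s j = 0 then u j else v j) * basis_projector n s $$ (r, c))"
proof -
  obtain x y where xy: "\<forall>j\<in>{1..<n}. x j < 2 \<and> y j < 2"
    and entry: "\<forall>A. (\<forall>j\<in>{1..<n}. A j \<in> carrier_mat 2 2) \<longrightarrow>
      node_op n A $$ (r, c) = (\<Prod>j\<in>{1..<n}. A j $$ (x j, y j))"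
    using node_op_entry [OF assms] by (elim exE conjE) (rule that)
  have "node_op n (\<lambda>j. qubit_diag (u j) (v j)) $$ (r, c)
      = (\<Prod>j\<in>{1..<n}. qubit_diag (u j) (v j) $$ (x j, y j))"
    by (rule entry [rule_format]) simp
  also have "\<dots> = (\<Prod>j\<in>{1..<n}. \<Sum>d\<in>{0, 1}. (if d = 0 then u j else v j) * ketbra d d $$ (x j, y j))"
  proof (rule prod.cong [OF refl])
    fix j
    assume "j \<in> {1..<n}"
    then have "x j = 0 \<or> x j = 1" "y j = 0 \<or> y j = 1"
      using xy by (simp_all add: less_2_cases_iff)
    then show "qubit_diag (u j) (v j) $$ (x j, y j)
        = (\<Sum>d\<in>{0, 1}. (if d = 0 then u j else v j) * ketbra d d $$ (x j, y j))"
      by (auto simp: qubit_diag_def ketbra_def)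
  qed
  also have "\<dots> = (\<Sum>s\<in>bitstrings n. \<Prod>j\<in>{1..<n}.
      (if s j = 0 then u j else v j) * ketbra (s j) (s j) $$ (x j, y j))"
    unfolding bitstrings_def by (rule prod_sum_PiE) auto
  also have "\<dots> = (\<Sum>s\<in>bitstrings n. (\<Prod>j\<in>{1..<n}. if s j = 0 then u j else v j)
      * basis_projector n s $$ (r, c))"
  proof (rule sum.cong [OF refl])
    fix s
    \<comment> \<open>The digits \<open>x\<close> and \<open>y\<close> were obtained for all
      families of operators at once, so they also describe this entry of the projector.\<close>
    have "basis_projector n s $$ (r, c) = (\<Prod>j\<in>{1..<n}. ketbra (s j) (s j) $$ (x j, y j))"
      unfolding basis_projector_def by (rule entry [rule_format]) simp
    then show "(\<Prod>j\<in>{1..<n}. (if s j = 0 then u j else v j) * ketbra (s j) (s j) $$ (x j, y j))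
        = (\<Prod>j\<in>{1..<n}. if s j = 0 then u j else v j) * basis_projector n s $$ (r, c)"
      by (simp only: prod.distrib)
  qed
  finally show ?thesis .
qed

text \<open>On a bit string \<open>s j = 1\<close> is the negation of \<open>s j = 0\<close>, so the
  products over the two level sets merge into one product over all nodes.\<close>

lemma alpha_eq:
  assumes "s \<in> bitstrings n"
  shows "alpha n \<theta> s = \<theta> $ 0 * (\<Prod>j\<in>{1..<n}. if s j = 0 then \<theta> $ j else 1 - \<theta> $ j)
    + (1 - \<theta> $ 0) * (\<Prod>j\<in>{1..<n}. if s j = 0 then 1 - \<theta> $ j else \<theta> $ j)"
proof -
  have "\<forall>j\<in>{1..<n}. s j = 0 \<or> s j = 1"
    using assms by (auto simp: bitstrings_def PiE_def Pi_def)
  then have "{j \<in> {1..<n}. s j = 1} = {1..<n} \<inter> - {j. s j = 0}"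
    "{j \<in> {1..<n}. s j = 0} = {1..<n} \<inter> {j. s j = 0}"
    by auto
  then show ?thesis
    unfolding alpha_def by (simp add: prod.If_cases mult.assoc mult.commute mult.left_commute)
qed

lemma distributed_state_expansion:
  assumes n: "n \<ge> 2"
  shows "distributed_state n \<theta> =
    finsum (module_mat TYPE(complex) (2 ^ (n - 1)) (2 ^ (n - 1)))
      (\<lambda>s. complex_of_real (alpha n \<theta> s) \<cdot>\<^sub>m basis_projector n s) (bitstrings n)"
    (is "?L = finsum ?R ?f ?S")
proof (rule eq_matI)
  let ?N = "2 ^ (n - 1) :: nat"
  have P: "basis_projector n s \<in> carrier_mat ?N ?N" for s
    unfolding basis_projector_def by (rule node_op_carrier) simp
  then have f: "?f s \<in> carrier_mat ?N ?N" for s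
    by simp
  note finsum = module_mat_finsum [OF finite_bitstrings, of n ?f, OF f]
  have D: "node_op n (\<lambda>j. qubit_diag (u j) (v j)) \<in> carrier_mat ?N ?N" for u v
    by (rule node_op_carrier) simp
  note dims = finsum(1) [THEN carrier_matD(1)] finsum(1) [THEN carrier_matD(2)]
    D [THEN carrier_matD(1)] D [THEN carrier_matD(2)]
    P [THEN carrier_matD(1)] P [THEN carrier_matD(2)]
  show "dim_row ?L = dim_row (finsum ?R ?f ?S)" "dim_col ?L = dim_col (finsum ?R ?f ?S)"
    by (simp_all add: distributed_state_eq [OF n] dims del: One_nat_def)
  fix r c
  assume "r < dim_row (finsum ?R ?f ?S)" "c < dim_col (finsum ?R ?f ?S)"
  then have r: "r < ?N" and c: "c < ?N"
    by (simp_all add: dims del: One_nat_def)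
  \<comment> \<open>The weights are kept as images of real products, to be matched with the
    real-valued \<open>alpha\<close>.\<close>
  define w where "w u v s = (\<Prod>j\<in>{1..<n}. if s j = (0::nat) then u j else v j)"
    for u v :: "nat \<Rightarrow> real" and s
  have w: "(\<Prod>j\<in>{1..<n}. if s j = 0 then complex_of_real (u j) else of_real (v j))
      = of_real (w u v s)" for u v s
    unfolding w_def of_real_prod by (rule prod.cong) auto
  have "?L $$ (r, c) = (\<Sum>s\<in>?S. of_real (\<theta> $ 0) *
        (of_real (w (\<lambda>j. \<theta> $ j) (\<lambda>j. 1 - \<theta> $ j) s) * basis_projector n s $$ (r, c))
      + of_real (1 - \<theta> $ 0) *
        (of_real (w (\<lambda>j. 1 - \<theta> $ j) (\<lambda>j. \<theta> $ j) s) * basis_projector n s $$ (r, c)))"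
    using r c
    by (simp add: distributed_state_eq [OF n] dims node_op_qubit_diag_entry w sum.distrib
        sum_distrib_left del: of_real_diff One_nat_def)
  also have "\<dots> = (\<Sum>s\<in>?S. ?f s $$ (r, c))"
    using r c by (intro sum.cong) (simp_all add: alpha_eq dims w_def algebra_simps del: One_nat_def)
  also have "\<dots> = finsum ?R ?f ?S $$ (r, c)"
    using r c by (rule finsum(2) [symmetric])
  finally show "?L $$ (r, c) = finsum ?R ?f ?S $$ (r, c)" .
qed

section \<open>Outcome probabilities\<close>

text \<open>The trace of a product operator is a product of traces. A measured node contributes its
  weight of outcome 1, an unmeasured one contributes total weight 1, so only the nodes in
  \<open>J\<close> remain in each of the two terms.\<close>

lemma outcome_prob_ones:
  assumes n: "n \<ge> 2" and J: "J \<subseteq> {1..<n}"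
  shows "outcome_prob n (distributed_state n \<theta>) J (\<lambda>_. 1)
    = \<theta> $ 0 * (\<Prod>j\<in>J. 1 - \<theta> $ j) + (1 - \<theta> $ 0) * (\<Prod>j\<in>J. \<theta> $ j)"
proof -
  let ?N = "2 ^ (n - 1) :: nat"
  define P where "P j = (if j \<in> J then qubit_diag 0 1 else qubit_diag 1 1)" for j
  define D where "D u v j = qubit_diag (complex_of_real (u j)) (complex_of_real (v j))"
    for u v :: "nat \<Rightarrow> real" and j
  have P_carrier: "P j \<in> carrier_mat 2 2" and D_carrier: "D u v j \<in> carrier_mat 2 2" for j u v
    by (simp_all add: P_def D_def)
  note P = node_op_carrier [of P n, OF P_carrier]
  have D: "node_op n (D u v) \<in> carrier_mat ?N ?N" for u v
    by (rule node_op_carrier) (rule D_carrier)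
  have tr: "trace (node_op n P * node_op n (D u v)) = of_real (\<Prod>j\<in>J. v j)"
    if uv: "\<And>j. u j + v j = 1" for u v
  proof -
    have "trace (node_op n P * node_op n (D u v)) = trace (node_op n (\<lambda>j. P j * D u v j))"
      by (simp only: node_op_mult P_carrier D_carrier)
    also have "\<dots> = (\<Prod>j\<in>{1..<n}. trace (P j * D u v j))"
      by (rule trace_node_op) (rule mult_carrier_mat [OF P_carrier D_carrier])
    also have "\<dots> = (\<Prod>j\<in>{1..<n}. of_real (if j \<in> J then v j else 1))"
      using uv
      by (intro prod.cong)
        (simp_all add: P_def D_def qubit_diag_mult trace_qubit_diag of_real_add [symmetric]
          del: of_real_add)
    also have "\<dots> = of_real (\<Prod>j\<in>J. v j)"
      unfolding of_real_prod
      using J by (intro prod.mono_neutral_cong_right) auto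
    finally show ?thesis .
  qed
  have "outcome_prob n (distributed_state n \<theta>) J (\<lambda>_. 1)
      = Re (trace (node_op n P * (of_real (\<theta> $ 0) \<cdot>\<^sub>m node_op n (D (\<lambda>j. \<theta> $ j) (\<lambda>j. 1 - \<theta> $ j))
        + of_real (1 - \<theta> $ 0) \<cdot>\<^sub>m node_op n (D (\<lambda>j. 1 - \<theta> $ j) (\<lambda>j. \<theta> $ j)))))"
    unfolding outcome_prob_def distributed_state_eq [OF n] P_def D_def ketbra_eq_qubit_diag
      one_mat_eq_qubit_diag ..
  also have "\<dots> = Re (trace (of_real (\<theta> $ 0) \<cdot>\<^sub>m (node_op n P * node_op n (D (\<lambda>j. \<theta> $ j) (\<lambda>j. 1 - \<theta> $ j)))
        + of_real (1 - \<theta> $ 0) \<cdot>\<^sub>m (node_op n P * node_op n (D (\<lambda>j. 1 - \<theta> $ j) (\<lambda>j. \<theta> $ j)))))"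
    by (simp only: mult_smult_distrib [OF P D]
        mult_add_distrib_mat [OF P smult_carrier_mat [OF D] smult_carrier_mat [OF D]])
  also have "\<dots> = \<theta> $ 0 * (\<Prod>j\<in>J. 1 - \<theta> $ j) + (1 - \<theta> $ 0) * (\<Prod>j\<in>J. \<theta> $ j)"
    by (subst trace_lincomb [OF mult_carrier_mat [OF P D] mult_carrier_mat [OF P D]])
      (simp add: tr of_real_mult [symmetric] of_real_add [symmetric] del: of_real_mult of_real_add of_real_diff of_real_prod)
  finally show ?thesis .
qed

lemma prob1_eq:
  assumes "n \<ge> 2" "j \<in> {1..<n}"
  shows "prob1 n \<theta> j = \<theta> $ 0 * (1 - \<theta> $ j) + (1 - \<theta> $ 0) * \<theta> $ j"
  using outcome_prob_ones [of n "{j}"] assms by (simp add: prob1_def)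

lemma prob2_eq:
  assumes "n \<ge> 2" "(j, k) \<in> node_pairs n"
  shows "prob2 n \<theta> j k
    = \<theta> $ 0 * (1 - \<theta> $ j) * (1 - \<theta> $ k) + (1 - \<theta> $ 0) * \<theta> $ j * \<theta> $ k"
  using outcome_prob_ones [of n "{j, k}"] assms by (simp add: prob2_def node_pairs_def)

section \<open>Solving for the parameters\<close>

text \<open>The unknown enters only through \<open>x * (1 - x)\<close>.\<close>

lemma root_eq_reflect: "root_eq p pp j k (1 - x) \<longleftrightarrow> root_eq p pp j k x"
  by (simp add: root_eq_def algebra_simps)

text \<open>Subtracting the equations of two roots \<open>x\<close> and \<open>y\<close> leaves a
  multiple of \<open>(x - y) * (1 - x - y)\<close>, and its coefficient is nonzero.\<close>

lemma root_eq_solution_set: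
  assumes "coeff_a p pp j k \<noteq> 0" "root_eq p pp j k x"
  shows "{y. root_eq p pp j k y} = {x, 1 - x}"
proof -
  have "y = x \<or> y = 1 - x" if "root_eq p pp j k y" for y
  proof -
    have "coeff_a p pp j k * ((x - y) * (1 - x - y)) = 0"
      using assms(2) that by (simp add: root_eq_def algebra_simps)
    then have "x - y = 0 \<or> 1 - x - y = 0"
      using assms(1) by simp
    then show ?thesis
      by auto
  qed
  then show ?thesis
    using assms(2) root_eq_reflect by auto
qed

lemma flipped_carrier [simp]: "flipped n v \<in> carrier_vec n"
  by (simp add: flipped_def)

lemma index_flipped [simp]: "j < n \<Longrightarrow> flipped n v $ j = 1 - v $ j"
  by (simp add: flipped_def)

lemma flipped_in_solutions:
  assumes "n \<ge> 1" "v \<in> solutions n P p pp"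
  shows "flipped n v \<in> solutions n P p pp"
  using assms by (auto simp: solutions_def root_eq_reflect algebra_simps)

lemma not_identified_solutions:
  assumes n: "n \<ge> 2"
  shows "\<not> identified (solutions n P p pp)"
proof
  assume "identified (solutions n P p pp)"
  then obtain v where v: "v \<in> solutions n P p pp"
    and unique: "\<And>w. w \<in> solutions n P p pp \<Longrightarrow> w = v"
    by (auto simp: identified_def)
  have carrier: "v \<in> carrier_vec n"
    using v by (simp add: solutions_def)
  have "flipped n v = v"
    using n v by (intro unique flipped_in_solutions) auto
  from arg_cong [OF this, of "\<lambda>w. w $ 0"] have half: "v $ 0 = 1 / 2"
    using n by simp
  \<comment> \<open>At \<open>v $ 0 = 1 / 2\<close> the equation for \<open>p j\<close> does not constrain \<open>v $ j\<close> at all.\<close>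
  define w where "w = vec n (\<lambda>j. if j = 0 then 1 / 2 else v $ j + 1)"
  have "w \<in> solutions n P p pp"
    using n v half by (auto simp: solutions_def w_def algebra_simps)
  then have "w = v"
    by (rule unique)
  from arg_cong [OF this, of "\<lambda>u. u $ 1"] show False
    using n by (simp add: w_def)
qed

text \<open>For a fixed value \<open>x\<close> of the component 0, the equation for
  \<open>p j\<close> reads \<open>p j - x = (1 - 2 * x) * v $ j\<close>, which is uniquely solvable.
  The equations of the pairs constrain only \<open>x\<close>.\<close>

lemma solutions_iff_estimate:
  assumes "n \<ge> 1" "x \<noteq> 1 / 2"
  shows "v \<in> solutions n P p pp \<and> v $ 0 = x
    \<longleftrightarrow> v = estimate n p x \<and> (\<forall>(j, k)\<in>P. root_eq p pp j k x)"
proof -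
  have x: "1 - 2 * x \<noteq> 0"
    using assms(2) by simp
  have marginal: "p j = x * (1 - t) + (1 - x) * t \<longleftrightarrow> t = (p j - x) / (1 - 2 * x)" for j t
    using x by (auto simp: field_simps)
  have "v = estimate n p x \<longleftrightarrow>
      v \<in> carrier_vec n \<and> v $ 0 = x \<and> (\<forall>j\<in>{1..<n}. v $ j = (p j - x) / (1 - 2 * x))"
    using assms(1) by (auto simp: estimate_def)
  moreover have "v \<in> solutions n P p pp \<and> v $ 0 = x \<longleftrightarrow>
      v \<in> carrier_vec n \<and> v $ 0 = x \<and>
      (\<forall>j\<in>{1..<n}. p j = x * (1 - v $ j) + (1 - x) * v $ j) \<and>
      (\<forall>(j, k)\<in>P. root_eq p pp j k x)"
    by (auto simp: solutions_def)
  ultimately show ?thesis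
    unfolding marginal by blast
qed

lemma index_estimate_0 [simp]: "n \<ge> 1 \<Longrightarrow> estimate n p x $ 0 = x"
  by (simp add: estimate_def)

lemma solutions_eq_estimates:
  assumes n: "n \<ge> 1" and x: "x \<noteq> 1 / 2"
    and roots: "{y. \<forall>(j, k)\<in>P. root_eq p pp j k y} = {x, 1 - x}"
  shows "solutions n P p pp = {estimate n p x, estimate n p (1 - x)}"
proof -
  have x': "1 - x \<noteq> 1 / 2"
    using x by simp
  have "v \<in> solutions n P p pp \<Longrightarrow> v $ 0 \<in> {x, 1 - x}" for v
    unfolding roots [symmetric] by (auto simp: solutions_def)
  moreover have "\<forall>(j, k)\<in>P. root_eq p pp j k x" "\<forall>(j, k)\<in>P. root_eq p pp j k (1 - x)"
    using roots by auto
  ultimately show ?thesis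
    using solutions_iff_estimate [OF n x, of _ P p pp]
      solutions_iff_estimate [OF n x', of _ P p pp] by blast
qed

lemma identified_singleton: "identified {v}"
  by (simp add: identified_def)

text \<open>The numbers \<open>x\<close> and \<open>1 - x\<close> lie strictly on opposite sides of
  1/2, so each regime keeps exactly one of the two vectors.\<close>

lemma identified_noise_regimes:
  assumes "x \<noteq> 1 / 2" "u $ 0 = x" "w $ 0 = 1 - x"
  shows "identified ({u, w} \<inter> low_noise)" "identified ({u, w} \<inter> high_noise)"
proof -
  have "({u, w} \<inter> low_noise = {u} \<and> {u, w} \<inter> high_noise = {w}) \<or>
      ({u, w} \<inter> low_noise = {w} \<and> {u, w} \<inter> high_noise = {u})"
    using assms by (cases "x > 1 / 2") (auto simp: low_noise_def high_noise_def)
  then show "identified ({u, w} \<inter> low_noise)" "identified ({u, w} \<inter> high_noise)"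
    using identified_singleton by auto
qed

lemma unique_root_noise_regimes:
  fixes x :: real
  assumes "{y. R y} = {x, 1 - x}" "x \<noteq> 1 / 2"
  shows "\<exists>!y. R y \<and> y > 1 / 2" "\<exists>!y. R y \<and> y < 1 / 2"
proof -
  have R: "R y \<longleftrightarrow> y = x \<or> y = 1 - x" for y
    using assms(1) by auto
  show "\<exists>!y. R y \<and> y > 1 / 2"
    unfolding R using assms(2)
    by (intro ex1I [of _ "max x (1 - x)"]) (auto simp: max_def split: if_splits)
  show "\<exists>!y. R y \<and> y < 1 / 2"
    unfolding R using assms(2)
    by (intro ex1I [of _ "min x (1 - x)"]) (auto simp: min_def split: if_splits)
qed

lemma solve_single_pair:
  assumes n: "n \<ge> 1" and a: "coeff_a p pp j k \<noteq> 0" and root: "root_eq p pp j k x"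
    and x: "x \<noteq> 1 / 2"
  shows "{y. root_eq p pp j k y} = {x, 1 - x} \<and>
    solutions n {(j, k)} p pp = {estimate n p x, estimate n p (1 - x)} \<and>
    estimate n p x \<noteq> estimate n p (1 - x) \<and>
    (\<exists>!y. root_eq p pp j k y \<and> y > 1 / 2) \<and>
    (\<exists>!y. root_eq p pp j k y \<and> y < 1 / 2) \<and>
    identified (solutions n {(j, k)} p pp \<inter> low_noise) \<and>
    identified (solutions n {(j, k)} p pp \<inter> high_noise)"
proof -
  have roots: "{y. root_eq p pp j k y} = {x, 1 - x}"
    by (rule root_eq_solution_set [OF a root])
  then have sol: "solutions n {(j, k)} p pp = {estimate n p x, estimate n p (1 - x)}"
    by (intro solutions_eq_estimates n x) simp
  have "estimate n p x $ 0 \<noteq> estimate n p (1 - x) $ 0"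
    using n x by simp
  then have "estimate n p x \<noteq> estimate n p (1 - x)"
    by metis
  moreover have "identified (solutions n {(j, k)} p pp \<inter> low_noise)"
    "identified (solutions n {(j, k)} p pp \<inter> high_noise)"
    unfolding sol using n by (intro identified_noise_regimes [OF x]; simp)+
  ultimately show ?thesis
    using roots sol unique_root_noise_regimes [OF roots x] by blast
qed

section \<open>Exact probabilities and compatible parameters\<close>

text \<open>For exact probabilities, \<open>coeff_a p pp j k\<close> is \<open>(1 - 2 \<theta>\<^sub>j) (1 - 2 \<theta>\<^sub>k)\<close> and \<open>coeff_c p pp j k\<close>
  is minus the covariance of the two outcomes.\<close>

lemma root_eq_exact:
  assumes "p j = x * (1 - s) + (1 - x) * s" "p k = x * (1 - t) + (1 - x) * t"
    and "pp j k = x * (1 - s) * (1 - t) + (1 - x) * s * t"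
  shows "root_eq p pp j k x"
  unfolding root_eq_def coeff_a_def coeff_c_def assms by (simp add: algebra_simps)

text \<open>With the empty set of pairs, \<open>solutions_iff_estimate\<close> speaks about the
  one-node equations alone; the zero function is only a placeholder for the two-node
  statistics.\<close>

lemma estimate_exact:
  assumes "n \<ge> 1" "v \<in> carrier_vec n" "v $ 0 \<noteq> 1 / 2"
    and "\<And>j. j \<in> {1..<n} \<Longrightarrow> p j = v $ 0 * (1 - v $ j) + (1 - v $ 0) * v $ j"
  shows "estimate n p (v $ 0) = v"
  using assms solutions_iff_estimate [of n "v $ 0" v "{}" p "\<lambda>_ _. 0"]
  by (simp add: solutions_def)

lemma root_eq_prob:
  assumes "n \<ge> 2" "(j, k) \<in> node_pairs n"
  shows "root_eq (prob1 n \<theta>) (prob2 n \<theta>) j k (\<theta> $ 0)"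
  using assms by (intro root_eq_exact [of _ _ _ "\<theta> $ j" _ "\<theta> $ k"])
    (simp_all add: prob1_eq prob2_eq node_pairs_def)

lemma in_own_compatible: "\<theta> \<in> parameters n \<Longrightarrow> \<theta> \<in> compatible n \<theta>"
  by (auto simp: compatible_def)

text \<open>The flip exchanges the two summands in each of the formulas \<open>prob1_eq\<close> and
  \<open>prob2_eq\<close>, and it maps the interval from 0 to 1 to itself.\<close>

lemma flipped_in_compatible:
  assumes "n \<ge> 2" "\<theta> \<in> parameters n"
  shows "flipped n \<theta> \<in> compatible n \<theta>"
proof -
  have "prob1 n (flipped n \<theta>) j = prob1 n \<theta> j" if "j \<in> {1..<n}" for j
    using that assms(1) by (simp add: prob1_eq algebra_simps)
  moreover have "prob2 n (flipped n \<theta>) j k = prob2 n \<theta> j k" if "(j, k) \<in> node_pairs n" for j k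
  proof -
    have "j < n" "k < n"
      using that by (auto simp: node_pairs_def)
    then show ?thesis
      using that assms(1) by (simp add: prob2_eq algebra_simps)
  qed
  ultimately show ?thesis
    using assms(2) by (auto simp: compatible_def parameters_def)
qed

text \<open>A compatible \<open>v\<close> has the same statistics as \<open>\<theta>\<close>, so the
  equations may be written with the statistics of \<open>v\<close> itself, and these it satisfies by
  \<open>root_eq_prob\<close> and \<open>prob1_eq\<close>.\<close>

lemma compatible_subset_solutions:
  assumes n: "n \<ge> 2" and P: "P \<subseteq> node_pairs n"
  shows "compatible n \<theta> \<subseteq> solutions n P (prob1 n \<theta>) (prob2 n \<theta>)"
proof
  fix v
  assume v: "v \<in> compatible n \<theta>"
  have prob1: "prob1 n \<theta> j = prob1 n v j" if "j \<in> {1..<n}" for j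
    using v that by (auto simp: compatible_def)
  have "root_eq (prob1 n \<theta>) (prob2 n \<theta>) j k (v $ 0)" if "(j, k) \<in> P" for j k
  proof -
    have jk: "(j, k) \<in> node_pairs n"
      using P that by auto
    then have "prob2 n \<theta> j k = prob2 n v j k"
      using v by (auto simp: compatible_def)
    moreover have "j \<in> {1..<n}" "k \<in> {1..<n}"
      using jk by (auto simp: node_pairs_def)
    ultimately show ?thesis
      using root_eq_prob [OF n jk, of v] prob1 by (simp add: root_eq_def coeff_a_def coeff_c_def)
  qed
  then show "v \<in> solutions n P (prob1 n \<theta>) (prob2 n \<theta>)"
    using v n prob1 by (auto simp: solutions_def compatible_def parameters_def prob1_eq)
qed

text \<open>One pair with nonzero leading coefficient already excludes all values other than
  \<open>\<theta> $ 0\<close> and its reflection, and both are roots for every pair. The compatible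
  vectors are squeezed between the pair of \<open>\<theta>\<close> and its flip and the set of all
  solutions.\<close>

lemma exact_solutions:
  assumes n: "n \<ge> 2" and \<theta>: "\<theta> \<in> parameters n" and half: "\<theta> $ 0 \<noteq> 1 / 2"
    and P: "P \<subseteq> node_pairs n" and a: "\<exists>(j, k)\<in>P. coeff_a (prob1 n \<theta>) (prob2 n \<theta>) j k \<noteq> 0"
  shows "{x. \<forall>(j, k)\<in>P. root_eq (prob1 n \<theta>) (prob2 n \<theta>) j k x} = {\<theta> $ 0, 1 - \<theta> $ 0}"
    and "solutions n P (prob1 n \<theta>) (prob2 n \<theta>) = {\<theta>, flipped n \<theta>}"
    and "compatible n \<theta> = {\<theta>, flipped n \<theta>}"
proof -
  let ?root = "root_eq (prob1 n \<theta>) (prob2 n \<theta>)"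
  have root: "?root j k (\<theta> $ 0)" if "(j, k) \<in> P" for j k
    using P that by (intro root_eq_prob n) auto
  obtain j k where jk: "(j, k) \<in> P" and "coeff_a (prob1 n \<theta>) (prob2 n \<theta>) j k \<noteq> 0"
    using a by auto
  then have "{x. ?root j k x} = {\<theta> $ 0, 1 - \<theta> $ 0}"
    by (intro root_eq_solution_set root)
  then show roots: "{x. \<forall>(j, k)\<in>P. ?root j k x} = {\<theta> $ 0, 1 - \<theta> $ 0}"
    using jk root root_eq_reflect by fast
  have carrier: "\<theta> \<in> carrier_vec n"
    using \<theta> by (simp add: parameters_def)
  have 1: "estimate n (prob1 n \<theta>) (\<theta> $ 0) = \<theta>"
    using n half carrier by (intro estimate_exact) (simp_all add: prob1_eq)
  \<comment> \<open>The flipped vector has the same one-node probabilities, so the estimate at its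
    own component 0 returns it.\<close>
  have "estimate n (prob1 n \<theta>) (flipped n \<theta> $ 0) = flipped n \<theta>"
    using n half by (intro estimate_exact) (simp_all add: prob1_eq algebra_simps)
  then have 2: "estimate n (prob1 n \<theta>) (1 - \<theta> $ 0) = flipped n \<theta>"
    using n by simp
  show sol: "solutions n P (prob1 n \<theta>) (prob2 n \<theta>) = {\<theta>, flipped n \<theta>}"
    using solutions_eq_estimates [OF _ half roots] n by (simp add: 1 2)
  show "compatible n \<theta> = {\<theta>, flipped n \<theta>}"
    using compatible_subset_solutions [OF n P, of \<theta>] in_own_compatible [OF \<theta>]
      flipped_in_compatible [OF n \<theta>] unfolding sol by auto
qed

theorem mainTheorem2:
  fixes n :: nat and \<theta> :: "real vec"
  assumes n: "n \<ge> 2" and \<theta>: "\<theta> \<in> parameters n"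
  shows
    \<comment> \<open>(i)\<close>
    "distributed_state n \<theta> =
       finsum (module_mat TYPE(complex) (2 ^ (n - 1)) (2 ^ (n - 1)))
         (\<lambda>s. complex_of_real (alpha n \<theta> s) \<cdot>\<^sub>m basis_projector n s) (bitstrings n)
     \<and>
     \<comment> \<open>(ii)\<close>
     (\<forall>j\<in>{1..<n}. prob1 n \<theta> j = \<theta> $ 0 * (1 - \<theta> $ j) + (1 - \<theta> $ 0) * \<theta> $ j) \<and>
     (\<forall>(j, k)\<in>node_pairs n.
        prob2 n \<theta> j k =
          \<theta> $ 0 * (1 - \<theta> $ j) * (1 - \<theta> $ k) + (1 - \<theta> $ 0) * \<theta> $ j * \<theta> $ k) \<and>
     (\<theta> $ 0 \<noteq> 1 / 2 \<longrightarrow>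
        (\<forall>j\<in>{1..<n}. \<theta> $ j = (prob1 n \<theta> j - \<theta> $ 0) / (1 - 2 * \<theta> $ 0)) \<and>
        (\<forall>(j, k)\<in>node_pairs n. root_eq (prob1 n \<theta>) (prob2 n \<theta>) j k (\<theta> $ 0)))
     \<and>
     \<comment> \<open>(iii), for arbitrary estimates \<open>q\<close>, \<open>qq\<close> of the probabilities\<close>
     (\<forall>q qq.
        (\<forall>(j, k)\<in>node_pairs n. \<forall>x. root_eq q qq j k x \<longrightarrow> root_eq q qq j k (1 - x)) \<and>
        (\<forall>x. (\<forall>(j, k)\<in>node_pairs n. root_eq q qq j k x) \<longrightarrow>
             (\<forall>(j, k)\<in>node_pairs n. root_eq q qq j k (1 - x))) \<and>
        (\<forall>P\<subseteq>node_pairs n. \<not> identified (solutions n P q qq)) \<and>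
        (\<forall>(j, k)\<in>node_pairs n. \<forall>x.
           coeff_a q qq j k \<noteq> 0 \<and> root_eq q qq j k x \<and> x \<noteq> 1 / 2 \<longrightarrow>
             {y. root_eq q qq j k y} = {x, 1 - x} \<and>
             solutions n {(j, k)} q qq = {estimate n q x, estimate n q (1 - x)} \<and>
             estimate n q x \<noteq> estimate n q (1 - x) \<and>
             (\<exists>!y. root_eq q qq j k y \<and> y > 1 / 2) \<and>
             (\<exists>!y. root_eq q qq j k y \<and> y < 1 / 2) \<and>
             identified (solutions n {(j, k)} q qq \<inter> low_noise) \<and>
             identified (solutions n {(j, k)} q qq \<inter> high_noise)))
     \<and>
     \<comment> \<open>(iii), for the exact probabilities: any set of pairs, a single one or all of them\<close>
     (\<theta> $ 0 \<noteq> 1 / 2 \<longrightarrow>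
        \<theta> \<noteq> flipped n \<theta> \<and>
        {\<theta>, flipped n \<theta>} \<subseteq> compatible n \<theta> \<and>
        {\<theta>, flipped n \<theta>} \<subseteq> solutions n (node_pairs n) (prob1 n \<theta>) (prob2 n \<theta>) \<and>
        (\<forall>P\<subseteq>node_pairs n. (\<exists>(j, k)\<in>P. coeff_a (prob1 n \<theta>) (prob2 n \<theta>) j k \<noteq> 0) \<longrightarrow>
           {x. \<forall>(j, k)\<in>P. root_eq (prob1 n \<theta>) (prob2 n \<theta>) j k x} = {\<theta> $ 0, 1 - \<theta> $ 0} \<and>
           solutions n P (prob1 n \<theta>) (prob2 n \<theta>) = {\<theta>, flipped n \<theta>} \<and>
           compatible n \<theta> = {\<theta>, flipped n \<theta>} \<and>
           (\<theta> $ 0 > 1 / 2 \<longrightarrow>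
              solutions n P (prob1 n \<theta>) (prob2 n \<theta>) \<inter> low_noise = {\<theta>}) \<and>
           (\<theta> $ 0 < 1 / 2 \<longrightarrow>
              solutions n P (prob1 n \<theta>) (prob2 n \<theta>) \<inter> high_noise = {\<theta>})))"
proof (intro conjI)
  show "distributed_state n \<theta> =
      finsum (module_mat TYPE(complex) (2 ^ (n - 1)) (2 ^ (n - 1)))
        (\<lambda>s. complex_of_real (alpha n \<theta> s) \<cdot>\<^sub>m basis_projector n s) (bitstrings n)"
    by (rule distributed_state_expansion [OF n])
next
  show "\<forall>j\<in>{1..<n}. prob1 n \<theta> j = \<theta> $ 0 * (1 - \<theta> $ j) + (1 - \<theta> $ 0) * \<theta> $ j"
    using prob1_eq [OF n] by blast
next
  show "\<forall>(j, k)\<in>node_pairs n. prob2 n \<theta> j k =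
      \<theta> $ 0 * (1 - \<theta> $ j) * (1 - \<theta> $ k) + (1 - \<theta> $ 0) * \<theta> $ j * \<theta> $ k"
    using prob2_eq [OF n] by blast
next
  show "\<theta> $ 0 \<noteq> 1 / 2 \<longrightarrow>
      (\<forall>j\<in>{1..<n}. \<theta> $ j = (prob1 n \<theta> j - \<theta> $ 0) / (1 - 2 * \<theta> $ 0)) \<and>
      (\<forall>(j, k)\<in>node_pairs n. root_eq (prob1 n \<theta>) (prob2 n \<theta>) j k (\<theta> $ 0))"
    using root_eq_prob [OF n] prob1_eq [OF n] by (auto simp: field_simps)
next
  show "\<forall>q qq.
      (\<forall>(j, k)\<in>node_pairs n. \<forall>x. root_eq q qq j k x \<longrightarrow> root_eq q qq j k (1 - x)) \<and>
      (\<forall>x. (\<forall>(j, k)\<in>node_pairs n. root_eq q qq j k x) \<longrightarrow>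
           (\<forall>(j, k)\<in>node_pairs n. root_eq q qq j k (1 - x))) \<and>
      (\<forall>P\<subseteq>node_pairs n. \<not> identified (solutions n P q qq)) \<and>
      (\<forall>(j, k)\<in>node_pairs n. \<forall>x.
         coeff_a q qq j k \<noteq> 0 \<and> root_eq q qq j k x \<and> x \<noteq> 1 / 2 \<longrightarrow>
           {y. root_eq q qq j k y} = {x, 1 - x} \<and>
           solutions n {(j, k)} q qq = {estimate n q x, estimate n q (1 - x)} \<and>
           estimate n q x \<noteq> estimate n q (1 - x) \<and>
           (\<exists>!y. root_eq q qq j k y \<and> y > 1 / 2) \<and>
           (\<exists>!y. root_eq q qq j k y \<and> y < 1 / 2) \<and>
           identified (solutions n {(j, k)} q qq \<inter> low_noise) \<and>
           identified (solutions n {(j, k)} q qq \<inter> high_noise))"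
    \<comment> \<open>This turns both reflection claims into trivial implications; only goals 3 and
      4 remain to be argued.\<close>
    unfolding root_eq_reflect
  proof (intro allI conjI impI ballI, goal_cases)
    case (3 q qq P)
    show ?case by (rule not_identified_solutions [OF n])
  next
    case (4 q qq jk)
    obtain j k where jk: "jk = (j, k)"
      by fastforce
    have "n \<ge> 1"
      using n by simp
    then show ?case
      unfolding jk prod.case by (intro allI impI, elim conjE) (rule solve_single_pair)
  qed auto
next
  show "\<theta> $ 0 \<noteq> 1 / 2 \<longrightarrow>
      \<theta> \<noteq> flipped n \<theta> \<and>
      {\<theta>, flipped n \<theta>} \<subseteq> compatible n \<theta> \<and>
      {\<theta>, flipped n \<theta>} \<subseteq> solutions n (node_pairs n) (prob1 n \<theta>) (prob2 n \<theta>) \<and>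
      (\<forall>P\<subseteq>node_pairs n. (\<exists>(j, k)\<in>P. coeff_a (prob1 n \<theta>) (prob2 n \<theta>) j k \<noteq> 0) \<longrightarrow>
         {x. \<forall>(j, k)\<in>P. root_eq (prob1 n \<theta>) (prob2 n \<theta>) j k x} = {\<theta> $ 0, 1 - \<theta> $ 0} \<and>
         solutions n P (prob1 n \<theta>) (prob2 n \<theta>) = {\<theta>, flipped n \<theta>} \<and>
         compatible n \<theta> = {\<theta>, flipped n \<theta>} \<and>
         (\<theta> $ 0 > 1 / 2 \<longrightarrow>
            solutions n P (prob1 n \<theta>) (prob2 n \<theta>) \<inter> low_noise = {\<theta>}) \<and>
         (\<theta> $ 0 < 1 / 2 \<longrightarrow>
            solutions n P (prob1 n \<theta>) (prob2 n \<theta>) \<inter> high_noise = {\<theta>}))"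
    (is "_ \<longrightarrow> ?A \<and> ?B \<and> ?C \<and> (\<forall>P\<subseteq>_. ?a P \<longrightarrow> ?D P)")
  proof (rule impI)
    assume half: "\<theta> $ 0 \<noteq> 1 / 2"
    have flipped_0: "flipped n \<theta> $ 0 = 1 - \<theta> $ 0"
      using n by simp
    then have "\<theta> $ 0 \<noteq> flipped n \<theta> $ 0"
      using half by simp
    then have ?A
      by metis
    moreover have B: ?B
      using in_own_compatible [OF \<theta>] flipped_in_compatible [OF n \<theta>] by simp
    moreover have ?C
      using B compatible_subset_solutions [OF n subset_refl] by (rule subset_trans)
    \<comment> \<open>By \<open>flipped_0\<close> the flipped vector lies on the other side of 1/2,
      so the regime that contains \<open>\<theta>\<close> excludes it.\<close>
    moreover have "?D P" if P: "P \<subseteq> node_pairs n" "?a P" for P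
      using exact_solutions [OF n \<theta> half P] flipped_0
      by (simp add: low_noise_def high_noise_def)
    ultimately show "?A \<and> ?B \<and> ?C \<and> (\<forall>P\<subseteq>node_pairs n. ?a P \<longrightarrow> ?D P)"
      by blast
  qed
qed

end
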